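(* For any integer $n\geq 2$, \[ B_n^+(t)=D_n^+(t)+nB_{n-1}^-(t),\qquad B_n^-(t)=D_n^-(t)+ntB_{n-1}^+(t). \]
   Context: $\mathfrak{B}_n$ is the set of signed permutations $\pi=\pi_1\cdots\pi_n$ of $[n]$ (each of $1,\dots,n$ appears exactly once, with a sign). With $\pi_0=0$, $\mathrm{des}_B(\pi)=|\{k\in\{0,\dots,n-1\}:\pi_k>\pi_{k+1}\}|$. $\mathfrak{D}_n\subset\mathfrak{B}_n$ is the set of signed permutations with an even number of negative entries; for $\pi\in\mathfrak{D}_n$, $\mathrm{Des}_D(\pi)=\{0 : \pi_1+\pi_2<0\}\cup\{k\in\{1,\dots,n-1\}:\pi_k>\pi_{k+1}\}$ and $\mathrm{des}_D(\pi)=|\mathrm{Des}_D(\pi)|$. Let $\mathfrak{B}_n^{+}=\{\pi\in\mathfrak{B}_n:\pi_n>0\}$, $\mathfrak{B}_n^{-}=\{\pi\in\mathfrak{B}_n:\pi_n<0\}$, $\mathfrak{D}_n^{\pm}=\mathfrak{D}_n\cap\mathfrak{B}_n^{\pm}$, and define the half Eulerian polynomials $B_n^{\pm}(t)=\sum_{\pi\in\mathfrak{B}_n^{\pm}}t^{\mathrm{des}_B(\pi)}$ and $D_n^{\pm}(t)=\sum_{\pi\in\mathfrak{D}_n^{\pm}}t^{\mathrm{des}_D(\pi)}$. *)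

theory Defs
  imports "HOL-Computational_Algebra.Polynomial"
begin

text \<open>A signed permutation is a word of integers. The entry \<open>\<pi>\<^sub>k\<close> is written \<open>entry \<pi> k\<close>,
  with 1-based positions and the convention \<open>\<pi>\<^sub>0 = 0\<close>.\<close>

definition entry :: "int list \<Rightarrow> nat \<Rightarrow> int" where
  "entry \<pi> k = (0 # \<pi>) ! k"

definition signed_perms :: "nat \<Rightarrow> int list set" where
  "signed_perms n = {\<pi>. distinct (map abs \<pi>) \<and> set (map abs \<pi>) = {1..int n}}"

definition even_signed_perms :: "nat \<Rightarrow> int list set" where
  "even_signed_perms n =
     {\<pi> \<in> signed_perms n. even (card {k \<in> {1..n}. entry \<pi> k < 0})}"

definition Des_B :: "int list \<Rightarrow> nat set" where
  "Des_B \<pi> = {k \<in> {0..<length \<pi>}. entry \<pi> k > entry \<pi> (k + 1)}"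

definition des_B :: "int list \<Rightarrow> nat" where
  "des_B \<pi> = card (Des_B \<pi>)"

text \<open>Only meaningful for words of length at least 2, since it refers to \<open>\<pi>\<^sub>2\<close>.\<close>

definition Des_D :: "int list \<Rightarrow> nat set" where
  "Des_D \<pi> = {k. k = 0 \<and> entry \<pi> 1 + entry \<pi> 2 < 0}
             \<union> {k \<in> {1..<length \<pi>}. entry \<pi> k > entry \<pi> (k + 1)}"

definition des_D :: "int list \<Rightarrow> nat" where
  "des_D \<pi> = card (Des_D \<pi>)"

definition signed_perms_pos :: "nat \<Rightarrow> int list set" where
  "signed_perms_pos n = {\<pi> \<in> signed_perms n. entry \<pi> n > 0}"

definition signed_perms_neg :: "nat \<Rightarrow> int list set" where
  "signed_perms_neg n = {\<pi> \<in> signed_perms n. entry \<pi> n < 0}"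

definition even_signed_perms_pos :: "nat \<Rightarrow> int list set" where
  "even_signed_perms_pos n = even_signed_perms n \<inter> signed_perms_pos n"

definition even_signed_perms_neg :: "nat \<Rightarrow> int list set" where
  "even_signed_perms_neg n = even_signed_perms n \<inter> signed_perms_neg n"

definition B_pos :: "nat \<Rightarrow> int poly" where
  "B_pos n = (\<Sum>\<pi>\<in>signed_perms_pos n. monom 1 (des_B \<pi>))"

definition B_neg :: "nat \<Rightarrow> int poly" where
  "B_neg n = (\<Sum>\<pi>\<in>signed_perms_neg n. monom 1 (des_B \<pi>))"

definition D_pos :: "nat \<Rightarrow> int poly" where
  "D_pos n = (\<Sum>\<pi>\<in>even_signed_perms_pos n. monom 1 (des_D \<pi>))"

definition D_neg :: "nat \<Rightarrow> int poly" where
  "D_neg n = (\<Sum>\<pi>\<in>even_signed_perms_neg n. monom 1 (des_D \<pi>))"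

text \<open>All the sums above range over finite sets.\<close>

lemma length_signed_perms: "\<pi> \<in> signed_perms n \<Longrightarrow> length \<pi> = n"
  using distinct_card[of "map abs \<pi>"] by (simp add: signed_perms_def)

lemma finite_signed_perms: "finite (signed_perms n)"
proof (rule finite_subset)
  show "signed_perms n \<subseteq> {\<pi>. set \<pi> \<subseteq> {- int n..int n} \<and> length \<pi> = n}"
  proof
    fix \<pi> assume \<pi>: "\<pi> \<in> signed_perms n"
    have "x \<in> {- int n..int n}" if "x \<in> set \<pi>" for x
    proof -
      have "\<bar>x\<bar> \<in> {1..int n}" using \<pi> that by (auto simp: signed_perms_def)
      then show ?thesis by auto
    qed
    then show "\<pi> \<in> {\<pi>. set \<pi> \<subseteq> {- int n..int n} \<and> length \<pi> = n}"
      using length_signed_perms[OF \<pi>] by blast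
  qed
qed (rule finite_lists_length_eq, simp)

end

theory Submission
  imports Defs
begin

text \<open>Flipping the sign of \<open>\<pi>\<^sub>1\<close> preserves \<open>des_D\<close> and switches the parity of the number of
  negative entries, so \<open>D\<^sub>n\<^sup>\<plusminus>\<close> is also the sum of \<open>t\<^bsup>des_D\<^esup>\<close> over all signed permutations
  with \<open>\<pi>\<^sub>1 > 0\<close>. Grouping the terms of \<open>B\<^sub>n\<^sup>\<plusminus>\<close> into the pairs that differ in the sign of
  \<open>\<pi>\<^sub>1\<close>, each pair exceeds the corresponding term of \<open>D\<^sub>n\<^sup>\<plusminus>\<close> by \<open>t\<^bsup>1 + d\<^esup>\<close>, where \<open>d\<close> is the
  number of descents of \<open>\<pi>\<^sub>2\<dots>\<pi>\<^sub>n\<close>. Standardizing \<open>\<pi>\<^sub>2\<dots>\<pi>\<^sub>n\<close> forgets \<open>\<pi>\<^sub>1\<close>, which had \<open>n\<close>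
  possible values. Finally, exchanging the positive and the negative values by an order
  isomorphism on each sign class turns \<open>1 + d\<close> into \<open>des_B\<close>, up to the sign of the last
  entry.\<close>

section \<open>Descents of words\<close>

text \<open>Common recursive form behind both statistics: \<open>des_B\<close> prepends 0,
  \<open>des_D\<close> adds the indicator of \<open>x + y < 0\<close>. It also serves for tails,
  where no initial 0 is wanted.\<close>

fun des :: "int list \<Rightarrow> nat" where
  "des (x # y # xs) = of_bool (x > y) + des (y # xs)"
| "des _ = 0"

lemma card_descents_eq_des:
  "card {k. Suc k < length xs \<and> xs ! k > xs ! Suc k} = des xs"
proof (induction xs rule: des.induct)
  case (1 x y xs)
  let ?S = "{k. Suc k < length (y # xs) \<and> (y # xs) ! k > (y # xs) ! Suc k}"
  have fin: "finite ?S"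
    by (rule finite_subset[of _ "{..<length (y # xs)}"]) auto
  have "{k. Suc k < length (x # y # xs) \<and> (x # y # xs) ! k > (x # y # xs) ! Suc k} =
      (if x > y then {0} else {}) \<union> Suc ` ?S" (is "?L = ?R")
  proof (rule set_eqI)
    fix k show "k \<in> ?L \<longleftrightarrow> k \<in> ?R"
      by (cases k) auto
  qed
  moreover have "card ?R = of_bool (x > y) + card ?S"
    using fin by (auto simp: card_insert_if card_image)
  ultimately show ?case
    using 1 by simp
qed auto

lemma des_B_eq_des: "des_B \<pi> = des (0 # \<pi>)"
  unfolding des_B_def Des_B_def entry_def card_descents_eq_des[symmetric]
  by (rule arg_cong[where f = card]) auto

lemma des_D_Cons_Cons:
  "des_D (x # y # w) = of_bool (x + y < 0) + des (x # y # w)"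
proof -
  let ?S = "{k. Suc k < length (x # y # w) \<and> (x # y # w) ! k > (x # y # w) ! Suc k}"
  have fin: "finite ?S"
    by (rule finite_subset[of _ "{..<length (x # y # w)}"]) auto
  have "Des_D (x # y # w) = (if x + y < 0 then {0} else {}) \<union> Suc ` ?S" (is "_ = ?R")
  proof (rule set_eqI)
    fix k show "k \<in> Des_D (x # y # w) \<longleftrightarrow> k \<in> ?R"
      by (cases k) (auto simp: Des_D_def entry_def)
  qed
  moreover have "card ?R = of_bool (x + y < 0) + card ?S"
    using fin by (auto simp: card_insert_if card_image)
  ultimately show ?thesis
    unfolding des_D_def card_descents_eq_des by simp
qed

lemma des_map_strict_mono:
  assumes "\<And>x y. x \<in> set w \<Longrightarrow> y \<in> set w \<Longrightarrow> h x > h y \<longleftrightarrow> x > y"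
  shows "des (map h w) = des w"
  using assms by (induction w rule: des.induct) auto

lemma entry_length: "\<pi> \<noteq> [] \<Longrightarrow> entry \<pi> (length \<pi>) = last \<pi>"
  by (simp add: entry_def last_conv_nth)

lemma card_negative_entries:
  "card {k \<in> {1..length \<pi>}. entry \<pi> k < 0} = length (filter (\<lambda>x. x < 0) \<pi>)"
proof -
  have "{k \<in> {1..length \<pi>}. entry \<pi> k < 0} = Suc ` {i. i < length \<pi> \<and> \<pi> ! i < 0}"
    (is "?L = ?R")
  proof (rule set_eqI)
    fix k show "k \<in> ?L \<longleftrightarrow> k \<in> ?R"
      by (cases k) (auto simp: entry_def)
  qed
  then show ?thesis
    by (simp add: card_image length_filter_conv_card)
qed

section \<open>Signed permutations by the sign of the last entry\<close>

text \<open>With the sign as a parameter, both identities are proved by one argument, for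
  \<open>s = 1\<close> and \<open>s = - 1\<close>.\<close>

definition signed_perms_last :: "int \<Rightarrow> nat \<Rightarrow> int list set" where
  "signed_perms_last s n = {\<pi> \<in> signed_perms n. sgn (last \<pi>) = s}"

lemma finite_signed_perms_last: "finite (signed_perms_last s n)"
  by (rule finite_subset[OF _ finite_signed_perms[of n]]) (auto simp: signed_perms_last_def)

lemma entry_last_signed_perms:
  assumes "\<pi> \<in> signed_perms n" "n \<ge> 1"
  shows "entry \<pi> n = last \<pi>"
  using assms length_signed_perms[of \<pi> n] entry_length[of \<pi>] by fastforce

lemma signed_perms_pos_eq: "n \<ge> 1 \<Longrightarrow> signed_perms_pos n = signed_perms_last 1 n"
  by (auto simp: signed_perms_pos_def signed_perms_last_def entry_last_signed_perms sgn_1_pos)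

lemma signed_perms_neg_eq: "n \<ge> 1 \<Longrightarrow> signed_perms_neg n = signed_perms_last (- 1) n"
  by (auto simp: signed_perms_neg_def signed_perms_last_def entry_last_signed_perms sgn_1_neg)

lemma even_signed_perms_Int_last:
  "even_signed_perms n \<inter> signed_perms_last s n =
    {\<pi> \<in> signed_perms_last s n. even (length (filter (\<lambda>x. x < 0) \<pi>))}"
proof -
  have "even (card {k \<in> {1..n}. entry \<pi> k < 0}) \<longleftrightarrow> even (length (filter (\<lambda>x. x < 0) \<pi>))"
    if "\<pi> \<in> signed_perms n" for \<pi>
    using card_negative_entries[of \<pi>] length_signed_perms[OF that] by simp
  then show ?thesis
    unfolding even_signed_perms_def signed_perms_last_def by blast
qed

lemma mem_signed_perms_iff:
  "\<pi> \<in> signed_perms n \<longleftrightarrow> distinct (map abs \<pi>) \<and> abs ` set \<pi> = {1..int n}"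
  by (simp add: signed_perms_def)

lemma signed_perms_nonzero: "\<pi> \<in> signed_perms n \<Longrightarrow> x \<in> set \<pi> \<Longrightarrow> x \<noteq> 0"
  by (force simp: mem_signed_perms_iff)

lemma signed_perms_Cons_Cons:
  assumes "\<pi> \<in> signed_perms n" "n \<ge> 2"
  obtains a b w where "\<pi> = a # b # w" "a \<noteq> 0" "\<bar>a\<bar> \<noteq> \<bar>b\<bar>"
proof -
  obtain a b w where "\<pi> = a # b # w"
    using length_signed_perms[OF assms(1)] assms(2)
    by (metis One_nat_def Suc_1 length_Suc_conv le_Suc_ex add_Suc)
  then show thesis
    using that assms(1) signed_perms_nonzero[OF assms(1)] by (auto simp: mem_signed_perms_iff)
qed

section \<open>Changing the sign of the first entry\<close>

definition flip_hd :: "int list \<Rightarrow> int list" where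
  "flip_hd \<pi> = - hd \<pi> # tl \<pi>"

lemma flip_hd_Cons [simp]: "flip_hd (a # w) = - a # w"
  by (simp add: flip_hd_def)

lemma flip_hd_mem_signed_perms_last:
  assumes "\<pi> \<in> signed_perms_last s n" "n \<ge> 2"
  shows "flip_hd \<pi> \<in> signed_perms_last s n"
proof -
  obtain a b w where "\<pi> = a # b # w"
    using assms signed_perms_Cons_Cons by (metis (lifting) mem_Collect_eq signed_perms_last_def)
  then show ?thesis
    using assms by (auto simp: signed_perms_last_def mem_signed_perms_iff)
qed

text \<open>Replacing \<open>a\<close> by \<open>- a\<close> makes the indicators of
  \<open>a + b < 0\<close> and \<open>a > b\<close> trade places; the later descents do not involve
  the first entry.\<close>

lemma des_D_flip_hd:
  assumes "\<pi> \<in> signed_perms n" "n \<ge> 2"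
  shows "des_D (flip_hd \<pi>) = des_D \<pi>"
proof -
  obtain a b w where "\<pi> = a # b # w" "\<bar>a\<bar> \<noteq> \<bar>b\<bar>"
    using assms by (rule signed_perms_Cons_Cons)
  then show ?thesis
    by (auto simp: des_D_Cons_Cons)
qed

abbreviation positive_hd :: "int list set \<Rightarrow> int list set" where
  "positive_hd A \<equiv> {\<pi> \<in> A. hd \<pi> > 0}"

lemma sum_even_signed_perms_last:
  fixes n :: nat
  assumes "n \<ge> 2"
  shows "(\<Sum>\<pi>\<in>even_signed_perms n \<inter> signed_perms_last s n. monom 1 (des_D \<pi>)) =
    (\<Sum>\<pi>\<in>positive_hd (signed_perms_last s n). monom (1::int) (des_D \<pi>))"
proof -
  let ?neg = "\<lambda>\<pi>. length (filter (\<lambda>x::int. x < 0) \<pi>)"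
  have flip: "hd \<pi> \<noteq> 0" "flip_hd (flip_hd \<pi>) = \<pi>" "even (?neg (flip_hd \<pi>)) \<longleftrightarrow> odd (?neg \<pi>)"
    "hd (flip_hd \<pi>) = - hd \<pi>" "des_D (flip_hd \<pi>) = des_D \<pi>"
    "flip_hd \<pi> \<in> signed_perms_last s n"
    if "\<pi> \<in> signed_perms_last s n" for \<pi>
  proof -
    have \<pi>: "\<pi> \<in> signed_perms n"
      using that by (simp add: signed_perms_last_def)
    then obtain a b w where "\<pi> = a # b # w" "a \<noteq> 0"
      using assms by (rule signed_perms_Cons_Cons)
    then show "hd \<pi> \<noteq> 0" "flip_hd (flip_hd \<pi>) = \<pi>" "even (?neg (flip_hd \<pi>)) \<longleftrightarrow> odd (?neg \<pi>)"
      "hd (flip_hd \<pi>) = - hd \<pi>"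
      by auto
    show "des_D (flip_hd \<pi>) = des_D \<pi>"
      using \<pi> assms by (rule des_D_flip_hd)
    show "flip_hd \<pi> \<in> signed_perms_last s n"
      using that assms by (rule flip_hd_mem_signed_perms_last)
  qed
  \<comment> \<open>A word and its flip form a pair with exactly one member having an even number of
    negative entries and exactly one having a positive head. The two maps pass between these
    representatives.\<close>
  show ?thesis
    unfolding even_signed_perms_Int_last
    by (rule sum.reindex_bij_witness[of _
          "\<lambda>\<pi>. if even (?neg \<pi>) then \<pi> else flip_hd \<pi>"
          "\<lambda>\<pi>. if hd \<pi> > 0 then \<pi> else flip_hd \<pi>"])
      (use flip in \<open>auto simp: not_less order.order_iff_strict\<close>)
qed

text \<open>Let \<open>d = des (b # w)\<close>. If \<open>a + b < 0\<close>, then also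
  \<open>a > b\<close>, and both sides have the exponents \<open>d + 1\<close> and
  \<open>d + 2\<close>. Otherwise \<open>des_B\<close> and \<open>des_D\<close> agree on
  \<open>a # b # w\<close>, and \<open>- a\<close> contributes only the descent from the initial
  0.\<close>

lemma des_B_flip_pair:
  assumes "a > 0" "\<bar>a\<bar> \<noteq> \<bar>b\<bar>"
  shows "monom (1::int) (des_B (a # b # w)) + monom 1 (des_B (- a # b # w)) =
    monom 1 (des_D (a # b # w)) + monom 1 (Suc (des (b # w)))"
  using assms by (auto simp: des_B_eq_des des_D_Cons_Cons)

lemma sum_des_B_eq_sum_des_D:
  fixes n :: nat
  assumes "n \<ge> 2"
  shows "(\<Sum>\<pi>\<in>signed_perms_last s n. monom (1::int) (des_B \<pi>)) =
    (\<Sum>\<pi>\<in>even_signed_perms n \<inter> signed_perms_last s n. monom 1 (des_D \<pi>)) +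
    (\<Sum>\<pi>\<in>positive_hd (signed_perms_last s n). monom 1 (Suc (des (tl \<pi>))))"
proof -
  let ?P = "signed_perms_last s n"
  have cons: "\<exists>a b w. \<pi> = a # b # w \<and> a \<noteq> 0 \<and> \<bar>a\<bar> \<noteq> \<bar>b\<bar>" if "\<pi> \<in> ?P" for \<pi>
  proof -
    have "\<pi> \<in> signed_perms n"
      using that by (simp add: signed_perms_last_def)
    then show ?thesis
      using assms by (rule signed_perms_Cons_Cons) blast
  qed
  have split: "?P = positive_hd ?P \<union> {\<pi> \<in> ?P. hd \<pi> < 0}"
    using cons by (auto simp: neq_iff) (metis list.sel(1) neqE)
  have "(\<Sum>\<pi>\<in>?P. monom (1::int) (des_B \<pi>)) =
      (\<Sum>\<pi>\<in>positive_hd ?P. monom 1 (des_B \<pi>)) + (\<Sum>\<pi>\<in>{\<pi> \<in> ?P. hd \<pi> < 0}. monom 1 (des_B \<pi>))"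
    by (subst split, rule sum.union_disjoint) (auto simp: finite_signed_perms_last)
  \<comment> \<open>The flip carries the negative half onto the positive one, so that both members
    of each pair occur under one sum.\<close>
  also have "(\<Sum>\<pi>\<in>{\<pi> \<in> ?P. hd \<pi> < 0}. monom (1::int) (des_B \<pi>)) =
      (\<Sum>\<pi>\<in>positive_hd ?P. monom 1 (des_B (flip_hd \<pi>)))"
  proof (rule sum.reindex_bij_witness[of _ flip_hd flip_hd])
    fix \<pi> assume "\<pi> \<in> {\<pi> \<in> ?P. hd \<pi> < 0}"
    then show "flip_hd \<pi> \<in> positive_hd ?P" "flip_hd (flip_hd \<pi>) = \<pi>"
      "monom (1::int) (des_B (flip_hd (flip_hd \<pi>))) = monom 1 (des_B \<pi>)"
      using cons[of \<pi>] flip_hd_mem_signed_perms_last[of \<pi> s n] assms by auto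
  next
    fix \<pi> assume "\<pi> \<in> positive_hd ?P"
    then show "flip_hd \<pi> \<in> {\<pi> \<in> ?P. hd \<pi> < 0}" "flip_hd (flip_hd \<pi>) = \<pi>"
      using cons[of \<pi>] flip_hd_mem_signed_perms_last[of \<pi> s n] assms by auto
  qed
  also have "(\<Sum>\<pi>\<in>positive_hd ?P. monom (1::int) (des_B \<pi>)) + \<dots> =
      (\<Sum>\<pi>\<in>positive_hd ?P. monom 1 (des_D \<pi>) + monom 1 (Suc (des (tl \<pi>))))"
    unfolding sum.distrib[symmetric]
  proof (rule sum.cong[OF refl])
    fix \<pi> assume "\<pi> \<in> positive_hd ?P"
    then obtain a b w where "\<pi> = a # b # w" "a > 0" "\<bar>a\<bar> \<noteq> \<bar>b\<bar>"
      using cons[of \<pi>] by auto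
    then show "monom (1::int) (des_B \<pi>) + monom 1 (des_B (flip_hd \<pi>)) =
        monom 1 (des_D \<pi>) + monom 1 (Suc (des (tl \<pi>)))"
      using des_B_flip_pair by simp
  qed
  finally show ?thesis
    by (simp add: sum.distrib sum_even_signed_perms_last[OF assms])
qed

section \<open>Removing the first entry and standardizing\<close>

text \<open>Shared by the three relabellings \<open>skip_value\<close>, \<open>close_gap\<close> and
  \<open>swap_signs\<close>: membership in \<open>signed_perms\<close> depends on absolute values
  only, where \<open>h\<close> acts as \<open>k\<close>.\<close>

lemma distinct_abs_map:
  fixes h :: "int \<Rightarrow> int"
  assumes "\<And>x. x \<in> set w \<Longrightarrow> \<bar>h x\<bar> = k \<bar>x\<bar>" "inj_on k (abs ` set w)" "distinct (map abs w)"
  shows "distinct (map abs (map h w))" "abs ` set (map h w) = k ` abs ` set w"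
proof -
  have eq: "map abs (map h w) = map k (map abs w)"
    using assms(1) by simp
  show "distinct (map abs (map h w))"
    unfolding eq using assms(2,3) by (simp add: distinct_map[of k] del: map_map)
  show "abs ` set (map h w) = k ` abs ` set w"
    using arg_cong[OF eq, of set] by (simp add: image_image)
qed

text \<open>For \<open>a > 0\<close> this is the increasing, odd bijection from the integers onto
  those other than \<open>a\<close> and \<open>- a\<close>; \<open>close_gap a\<close> inverts
  it.\<close>

definition skip_value :: "int \<Rightarrow> int \<Rightarrow> int" where
  "skip_value a x = (if a \<le> x then x + 1 else if x \<le> - a then x - 1 else x)"

definition close_gap :: "int \<Rightarrow> int \<Rightarrow> int" where
  "close_gap a x = (if a < x then x - 1 else if x < - a then x + 1 else x)"

lemma skip_value_Cons_mem:
  assumes "w \<in> signed_perms m" "a \<in> {1..int (Suc m)}"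
  shows "a # map (skip_value a) w \<in> signed_perms (Suc m)"
proof -
  \<comment> \<open>The action of \<open>skip_value a\<close> on absolute values, which leaves
    \<open>a\<close> free for the new head.\<close>
  let ?k = "\<lambda>x. if a \<le> x then x + 1 else x"
  have w: "distinct (map abs w)" "abs ` set w = {1..int m}"
    using assms(1) by (auto simp: mem_signed_perms_iff)
  have k: "?k ` {1..int m} = {1..int (Suc m)} - {a}"
  proof
    show "{1..int (Suc m)} - {a} \<subseteq> ?k ` {1..int m}"
    proof
      fix x assume "x \<in> {1..int (Suc m)} - {a}"
      then show "x \<in> ?k ` {1..int m}"
        using assms(2) by (intro image_eqI[of _ _ "if a < x then x - 1 else x"]) auto
    qed
  qed (use assms(2) in auto)
  have abs: "\<bar>skip_value a x\<bar> = ?k \<bar>x\<bar>" for x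
    using assms(2) by (auto simp: skip_value_def)
  have inj: "inj_on ?k (abs ` set w)"
    by (auto simp: inj_on_def split: if_splits)
  have d: "distinct (map abs (map (skip_value a) w))"
    using abs inj w(1) by (rule distinct_abs_map)
  have "abs ` set (map (skip_value a) w) = ?k ` abs ` set w"
    using abs inj w(1) by (rule distinct_abs_map)
  then have "abs ` set (map (skip_value a) w) = {1..int (Suc m)} - {a}"
    unfolding w(2) k .
  then show ?thesis
    using d assms(2) unfolding mem_signed_perms_iff list.map distinct.simps list.set image_insert set_map
    by auto
qed

lemma close_gap_mem:
  assumes "a # w \<in> signed_perms (Suc m)" "a > 0"
  shows "map (close_gap a) w \<in> signed_perms m"
proof -
  let ?k = "\<lambda>x. if a < x then x - 1 else x"
  have w: "distinct (map abs w)" "abs ` set w = {1..int (Suc m)} - {a}" and a: "a \<le> int (Suc m)"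
    using assms by (auto simp: mem_signed_perms_iff)
  have k: "?k ` ({1..int (Suc m)} - {a}) = {1..int m}"
  proof
    show "{1..int m} \<subseteq> ?k ` ({1..int (Suc m)} - {a})"
    proof
      fix x assume "x \<in> {1..int m}"
      then show "x \<in> ?k ` ({1..int (Suc m)} - {a})"
        using assms(2) by (intro image_eqI[of _ _ "if a \<le> x then x + 1 else x"]) auto
    qed
  qed (use assms(2) a in auto)
  have abs: "\<bar>close_gap a x\<bar> = ?k \<bar>x\<bar>" for x
    using assms(2) by (auto simp: close_gap_def)
  have inj: "inj_on ?k (abs ` set w)"
    unfolding w(2) by (auto simp: inj_on_def split: if_splits)
  show ?thesis
    using distinct_abs_map[OF abs inj w(1)] k w(2)
    by (simp add: mem_signed_perms_iff del: set_map map_map)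
qed

text \<open>A word corresponds to its head, with \<open>Suc m\<close> choices, and its standardized
  tail. The relabelling is increasing and keeps signs, so descents and the sign of the last entry
  survive; \<open>m \<ge> 1\<close> puts that last entry in the tail.\<close>

lemma sum_standardize_tl:
  assumes "m \<ge> 1"
  shows "(\<Sum>\<pi>\<in>positive_hd (signed_perms_last s (Suc m)). monom (1::int) (Suc (des (tl \<pi>)))) =
    of_nat (Suc m) * (\<Sum>w\<in>signed_perms_last s m. monom 1 (Suc (des w)))"
proof -
  let ?A = "{1..int (Suc m)}" and ?W = "signed_perms_last s m"
  have skip: "a # map (skip_value a) w \<in> positive_hd (signed_perms_last s (Suc m))"
    "map (close_gap a) (map (skip_value a) w) = w"
    "des (map (skip_value a) w) = des w" if "a \<in> ?A" "w \<in> ?W" for a w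
  proof -
    have w: "w \<in> signed_perms m" "sgn (last w) = s"
      using that by (auto simp: signed_perms_last_def)
    then have "w \<noteq> []"
      using length_signed_perms[of w m] assms by auto
    moreover have "sgn (skip_value a x) = sgn x" for x
      using that by (auto simp: skip_value_def sgn_if)
    ultimately show "a # map (skip_value a) w \<in> positive_hd (signed_perms_last s (Suc m))"
      using skip_value_Cons_mem[OF w(1) that(1)] w(2) that
      by (simp add: signed_perms_last_def last_map)
    show "map (close_gap a) (map (skip_value a) w) = w"
      using that by (auto simp: close_gap_def skip_value_def intro!: map_idI)
    show "des (map (skip_value a) w) = des w"
      using that by (intro des_map_strict_mono) (auto simp: skip_value_def)
  qed
  have close: "hd \<pi> \<in> ?A" "map (close_gap (hd \<pi>)) (tl \<pi>) \<in> ?W"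
    "hd \<pi> # map (skip_value (hd \<pi>)) (map (close_gap (hd \<pi>)) (tl \<pi>)) = \<pi>"
    if "\<pi> \<in> positive_hd (signed_perms_last s (Suc m))" for \<pi>
  proof -
    have \<pi>: "\<pi> \<in> signed_perms (Suc m)" "sgn (last \<pi>) = s" "hd \<pi> > 0"
      using that by (auto simp: signed_perms_last_def)
    have "length \<pi> = Suc m"
      using \<pi>(1) by (rule length_signed_perms)
    then obtain a w where [simp]: "\<pi> = a # w" and "w \<noteq> []"
      using assms by (cases \<pi>; cases "tl \<pi>") auto
    have a: "a > 0" and ne: "\<And>x. x \<in> set w \<Longrightarrow> \<bar>x\<bar> \<noteq> a" "\<And>x. x \<in> set w \<Longrightarrow> x \<noteq> 0"
      using \<pi> signed_perms_nonzero[OF \<pi>(1)] by (auto simp: mem_signed_perms_iff)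
    show "hd \<pi> \<in> ?A"
      using \<pi> by (auto simp: mem_signed_perms_iff)
    have "sgn (close_gap a x) = sgn x" if "x \<in> set w" for x
      using ne[OF that] a by (auto simp: close_gap_def sgn_if)
    then show "map (close_gap (hd \<pi>)) (tl \<pi>) \<in> ?W"
      using close_gap_mem[of a w m] \<pi> \<open>w \<noteq> []\<close>
      by (simp add: signed_perms_last_def last_map)
    have "map (skip_value a) (map (close_gap a) w) = w"
      using ne a by (force simp: close_gap_def skip_value_def intro!: map_idI)
    then show "hd \<pi> # map (skip_value (hd \<pi>)) (map (close_gap (hd \<pi>)) (tl \<pi>)) = \<pi>"
      by simp
  qed
  have "(\<Sum>\<pi>\<in>positive_hd (signed_perms_last s (Suc m)). monom (1::int) (Suc (des (tl \<pi>)))) =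
      (\<Sum>(a, w)\<in>?A \<times> ?W. monom 1 (Suc (des w)))"
  proof (rule sum.reindex_bij_witness[of _
        "\<lambda>(a, w). a # map (skip_value a) w"
        "\<lambda>\<pi>. (hd \<pi>, map (close_gap (hd \<pi>)) (tl \<pi>))"])
    fix \<pi> assume \<pi>: "\<pi> \<in> positive_hd (signed_perms_last s (Suc m))"
    let ?p = "(hd \<pi>, map (close_gap (hd \<pi>)) (tl \<pi>))"
    show "(case ?p of (a, w) \<Rightarrow> a # map (skip_value a) w) = \<pi>"
      unfolding prod.case using \<pi> by (rule close)
    show "?p \<in> ?A \<times> ?W"
      using close(1,2)[OF \<pi>] by (rule SigmaI)
    \<comment> \<open>Since \<open>skip_value\<close> preserves \<open>des\<close> and restores the
      tail from its image under \<open>close_gap\<close>, that image has the same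
      \<open>des\<close>.\<close>
    have "des (tl \<pi>) = des (map (close_gap (hd \<pi>)) (tl \<pi>))"
      using skip(3)[OF close(1,2)[OF \<pi>]] arg_cong[OF close(3)[OF \<pi>], of tl]
      unfolding list.sel by (rule subst[rotated])
    then show "(case ?p of (a, w) \<Rightarrow> monom (1::int) (Suc (des w))) = monom 1 (Suc (des (tl \<pi>)))"
      unfolding prod.case by (rule arg_cong[OF sym])
  next
    fix p assume "p \<in> ?A \<times> ?W"
    then obtain a w where [simp]: "p = (a, w)" and aw: "a \<in> ?A" "w \<in> ?W"
      by (rule SigmaE)
    show "(case p of (a, w) \<Rightarrow> a # map (skip_value a) w)
        \<in> positive_hd (signed_perms_last s (Suc m))"
      using skip(1)[OF aw] by simp
    show "(hd (case p of (a, w) \<Rightarrow> a # map (skip_value a) w),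
        map (close_gap (hd (case p of (a, w) \<Rightarrow> a # map (skip_value a) w)))
          (tl (case p of (a, w) \<Rightarrow> a # map (skip_value a) w))) = p"
      using skip(2)[OF aw] by (simp del: map_map)
  qed
  also have "\<dots> = of_nat (Suc m) * (\<Sum>w\<in>?W. monom 1 (Suc (des w)))"
    by (simp add: sum.cartesian_product[symmetric])
  finally show ?thesis .
qed

section \<open>Exchanging positive and negative values\<close>

text \<open>Maps \<open>1..m\<close> increasingly onto \<open>-m..-1\<close> and back; absolute
  values are reversed by \<open>x \<mapsto> m + 1 - x\<close>.\<close>

definition swap_signs :: "nat \<Rightarrow> int \<Rightarrow> int" where
  "swap_signs m x = (if x > 0 then x - int m - 1 else x + int m + 1)"

lemma swap_signs_mem:
  assumes "w \<in> signed_perms_last s m" "m \<ge> 1"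
  shows "map (swap_signs m) w \<in> signed_perms_last (- s) m"
    "map (swap_signs m) (map (swap_signs m) w) = w"
proof -
  let ?k = "\<lambda>x. int m + 1 - x"
  have w: "distinct (map abs w)" "abs ` set w = {1..int m}" "sgn (last w) = s"
    using assms by (auto simp: signed_perms_last_def mem_signed_perms_iff)
  have rng: "x \<noteq> 0" "\<bar>x\<bar> \<le> int m" if "x \<in> set w" for x
    using w(2) that by force+
  have abs: "\<bar>swap_signs m x\<bar> = ?k \<bar>x\<bar>" if "x \<in> set w" for x
    using rng[OF that] by (auto simp: swap_signs_def)
  have sgn: "sgn (swap_signs m x) = - sgn x" if "x \<in> set w" for x
    using rng[OF that] by (auto simp: swap_signs_def sgn_if)
  have inj: "inj_on ?k (abs ` set w)"
    by (auto simp: inj_on_def)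
  have k: "?k ` {1..int m} = {1..int m}"
  proof
    show "{1..int m} \<subseteq> ?k ` {1..int m}"
    proof
      fix x assume "x \<in> {1..int m}"
      then show "x \<in> ?k ` {1..int m}"
        by (intro image_eqI[of _ _ "?k x"]) auto
    qed
  qed auto
  have "w \<noteq> []"
    using w(2) assms(2) by auto
  then show "map (swap_signs m) w \<in> signed_perms_last (- s) m"
    using distinct_abs_map[OF abs inj w(1)] k w(2,3) sgn
    by (simp add: signed_perms_last_def mem_signed_perms_iff last_map del: set_map map_map)
  show "map (swap_signs m) (map (swap_signs m) w) = w"
    using rng by (force simp: swap_signs_def intro!: map_idI)
qed

text \<open>One step \<open>x, y\<close> changes its descent indicator by \<open>[y > 0] - [x > 0]\<close>, which telescopes.\<close>

lemma des_map_swap_signs: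
  assumes "w \<noteq> []" "\<And>x. x \<in> set w \<Longrightarrow> x \<noteq> 0 \<and> \<bar>x\<bar> \<le> int m"
  shows "des (map (swap_signs m) w) + of_bool (hd w > 0) = des w + of_bool (last w > 0)"
  using assms
proof (induction w rule: des.induct)
  case (1 x y w)
  have "des (map (swap_signs m) (y # w)) + of_bool (y > 0) = des (y # w) + of_bool (last (y # w) > 0)"
    using 1 by simp
  \<comment> \<open>Entries of equal sign keep their order, entries of opposite sign reverse
    it.\<close>
  moreover have "of_bool (swap_signs m x > swap_signs m y) + of_bool (x > 0) =
      of_bool (x > y) + (of_bool (y > 0) :: nat)"
    using "1.prems"(2)[of x] "1.prems"(2)[of y] by (auto simp: swap_signs_def)
  ultimately show ?case
    by simp
qed auto

text \<open>The initial 0 yields a descent exactly when the original head is positive. This is the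
  boundary term at the head in \<open>des_map_swap_signs\<close>, so only the one at the last entry
  remains.\<close>

lemma des_B_map_swap_signs:
  assumes "w \<in> signed_perms_last s m" "m \<ge> 1"
  shows "des_B (map (swap_signs m) w) = des w + of_bool (s = 1)"
proof -
  have w: "abs ` set w = {1..int m}" "sgn (last w) = s"
    using assms by (auto simp: signed_perms_last_def mem_signed_perms_iff)
  have rng: "x \<noteq> 0 \<and> \<bar>x\<bar> \<le> int m" if "x \<in> set w" for x
    using w(1) that by force
  obtain x v where xv: "w = x # v"
    using w(1) assms(2) by (cases w) auto
  have "des_B (map (swap_signs m) w) = of_bool (x > 0) + des (map (swap_signs m) w)"
    using rng[of x] by (auto simp: xv des_B_eq_des swap_signs_def)
  then show ?thesis
    using des_map_swap_signs[of w m] rng w(2) by (auto simp: xv sgn_1_pos)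
qed

text \<open>For \<open>s = 1\<close> the successor is absorbed by the boundary term at the last
  entry; for \<open>s = - 1\<close> it persists. Hence only the second recurrence has a factor
  \<open>t\<close>.\<close>

lemma sum_des_eq_sum_des_B:
  assumes "m \<ge> 1" "s = 1 \<or> s = - 1"
  shows "(\<Sum>w\<in>signed_perms_last s m. monom (1::int) (Suc (des w))) =
    (\<Sum>w\<in>signed_perms_last (- s) m. monom 1 (des_B w + of_bool (s = - 1)))"
proof (rule sum.reindex_bij_witness[of _ "map (swap_signs m)" "map (swap_signs m)"])
  fix w assume w: "w \<in> signed_perms_last s m"
  show "monom (1::int) (des_B (map (swap_signs m) w) + of_bool (s = - 1)) = monom 1 (Suc (des w))"
    using assms(2) by (auto simp: des_B_map_swap_signs[OF w assms(1)])
next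
  fix w assume "w \<in> signed_perms_last (- s) m"
  then show "map (swap_signs m) w \<in> signed_perms_last s m"
    using swap_signs_mem(1)[of w "- s" m] assms(1) by simp
qed (use swap_signs_mem assms(1) in blast)+

section \<open>The recurrences\<close>

lemma half_Eulerian_recurrence:
  fixes n :: nat
  assumes "n \<ge> 2" "s = 1 \<or> s = - 1"
  shows "(\<Sum>\<pi>\<in>signed_perms_last s n. monom (1::int) (des_B \<pi>)) =
    (\<Sum>\<pi>\<in>even_signed_perms n \<inter> signed_perms_last s n. monom 1 (des_D \<pi>)) +
    of_nat n * (\<Sum>w\<in>signed_perms_last (- s) (n - 1). monom 1 (des_B w + of_bool (s = - 1)))"
proof -
  have "n - 1 \<ge> 1" "Suc (n - 1) = n"
    using assms(1) by auto
  then show ?thesis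
    using sum_des_B_eq_sum_des_D[OF assms(1), of s] sum_standardize_tl[of "n - 1" s]
      sum_des_eq_sum_des_B[of "n - 1" s] assms(2) by simp
qed

theorem theorem1p3:
  fixes n :: nat
  assumes "n \<ge> 2"
  shows "B_pos n = D_pos n + of_nat n * B_neg (n - 1) \<and>
         B_neg n = D_neg n + of_nat n * monom 1 1 * B_pos (n - 1)"
proof
  have n: "n \<ge> 1" "n - 1 \<ge> 1"
    using assms by auto
  note defs = B_pos_def B_neg_def D_pos_def D_neg_def even_signed_perms_pos_def
    even_signed_perms_neg_def signed_perms_pos_eq[OF n(1)] signed_perms_neg_eq[OF n(1)]
    signed_perms_pos_eq[OF n(2)] signed_perms_neg_eq[OF n(2)]
  show "B_pos n = D_pos n + of_nat n * B_neg (n - 1)"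
    unfolding defs using half_Eulerian_recurrence[OF assms, of 1] by simp
  \<comment> \<open>The extra 1 in the exponent comes out as the polynomial \<open>t\<close>,
    written \<open>monom 1 1\<close>.\<close>
  have "(\<Sum>w\<in>signed_perms_last 1 (n - 1). monom (1::int) (des_B w + 1)) =
      monom 1 1 * (\<Sum>w\<in>signed_perms_last 1 (n - 1). monom 1 (des_B w))"
    by (simp add: sum_distrib_left mult_monom)
  then show "B_neg n = D_neg n + of_nat n * monom 1 1 * B_pos (n - 1)"
    unfolding defs using half_Eulerian_recurrence[OF assms, of "- 1"] by (simp add: mult.assoc)
qed

end
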